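(* For every integer $n\geqslant 1$, $\lfloor s_{n-1}\rfloor=v_5(n)$.
   Context: $v_5(n)$ denotes the $5$-adic valuation of the positive integer $n$, and $\lfloor x\rfloor$ the integral part of $x$. Define triples of integers $N_n=(a_n;b_n;c_n)$ for every integer $n\geqslant 1$ as the labels of the vertices of a quinary tree $\mathcal{A}_5$ read from the top and, at each level, from left to right. The top is $N_1=(1;3;0)$. For every $n\geqslant 1$, the first, second, third, fourth and fifth children of $N_n=(a;b;c)$ are respectively $N_{5n-3}$, $N_{5n-2}$, $N_{5n-1}$, $N_{5n}$, $N_{5n+1}$, and they are given by: - if $3\nmid b$: $N_{5n-3}=(3(4c+3)a-2b;\,3(6c+5)a-3b;\,0)$, $N_{5n-2}=((6c+5)a-b;\,6(c+1)a-b;\,0)$, $N_{5n-1}=(6(c+1)a-b;\,3a;\,0)$, $N_{5n}=(a;\,3a+b;\,c+1)$, $N_{5n+1}=(3a+b;\,6a+3b;\,0)$; - if $3\mid b$: $N_{5n-3}=((4c+3)a-\frac{2b}{3};\,(6c+5)a-b;\,0)$, $N_{5n-2}=((6c+5)a-b;\,6(c+1)a-b;\,0)$, $N_{5n-1}=(2(c+1)a-\frac{b}{3};\,a;\,0)$, $N_{5n}=(a;\,3a+b;\,c+1)$, $N_{5n+1}=(a+\frac{b}{3};\,2a+b;\,0)$. The sequence $(s_n)_{n\geqslant 0}$ is defined by $s_0=0$ and $s_n=\frac{a_n}{b_n}$ for every $n\geqslant 1$. *)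

theory Defs
  imports Complex_Main "HOL-Computational_Algebra.Computational_Algebra"
begin

(* The divisions by 3 in the second branch are exact, since 3 dvd b there. *)
definition children :: "int \<times> int \<times> int \<Rightarrow> (int \<times> int \<times> int) list" where
  "children = (\<lambda>(a, b, c).
     if \<not> 3 dvd b then
       [(3 * (4 * c + 3) * a - 2 * b, 3 * (6 * c + 5) * a - 3 * b, 0),
        ((6 * c + 5) * a - b, 6 * (c + 1) * a - b, 0),
        (6 * (c + 1) * a - b, 3 * a, 0),
        (a, 3 * a + b, c + 1),
        (3 * a + b, 6 * a + 3 * b, 0)]
     else
       [((4 * c + 3) * a - (2 * b) div 3, (6 * c + 5) * a - b, 0),
        ((6 * c + 5) * a - b, 6 * (c + 1) * a - b, 0),
        (2 * (c + 1) * a - b div 3, a, 0),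
        (a, 3 * a + b, c + 1),
        (a + b div 3, 2 * a + b, 0)])"

(* The parent of the vertex n \<ge> 2 is (n + 3) div 5, and n is its child number
   (n + 3) mod 5, counted from 0; see N_children below. The value at 0 is irrelevant. *)
function N :: "nat \<Rightarrow> int \<times> int \<times> int" where
  "N n = (if n \<le> 1 then (1, 3, 0)
          else children (N ((n + 3) div 5)) ! ((n + 3) mod 5))"
  by pat_completeness auto
termination by (relation "measure id") auto

declare N.simps [simp del]

lemma N_1: "N 1 = (1, 3, 0)"
  by (simp add: N.simps)

lemma N_child:
  assumes "n \<ge> 1" "j < 5"
  shows "N (5 * n + j - 3) = children (N n) ! j"
proof -
  have "(5 * n + j - 3 + 3) div 5 = n" "(5 * n + j - 3 + 3) mod 5 = j" "\<not> 5 * n + j - 3 \<le> 1"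
    using assms by auto
  then show ?thesis
    by (subst N.simps) simp
qed

lemma N_children:
  assumes "n \<ge> 1"
  shows "[N (5 * n - 3), N (5 * n - 2), N (5 * n - 1), N (5 * n), N (5 * n + 1)] = children (N n)"
proof -
  have "length (children (N n)) = 5"
    by (simp add: children_def split: prod.split)
  moreover have "5 * n + 1 - 3 = 5 * n - 2" "5 * n + 2 - 3 = 5 * n - 1"
    "5 * n + 3 - 3 = 5 * n" "5 * n + 4 - 3 = 5 * n + 1"
    using assms by auto
  ultimately show ?thesis
    using N_child[OF assms, of 0] N_child[OF assms, of 1] N_child[OF assms, of 2]
      N_child[OF assms, of 3] N_child[OF assms, of 4]
    by (auto simp: list_eq_iff_nth_eq less_Suc_eq numeral_eq_Suc)
qed

definition s :: "nat \<Rightarrow> real" where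
  "s n = (if n = 0 then 0 else (case N n of (a, b, c) \<Rightarrow> of_int a / of_int b))"

end

theory Submission
  imports Defs
begin

text \<open>
  Put \<open>t = b / (3a)\<close> for a vertex \<open>(a; b; c)\<close>, so that its fraction is \<open>a / b = 1 / (3t)\<close>.
  The two branches of the rule for the children differ by a common factor \<open>3\<close> of the first two
  entries (the first and last child, and the third), hence the fractions of the children are given
  by a single rule in \<open>t\<close> and \<open>c\<close>. Everything rests on the invariant \<open>c < t \<le> c + 1\<close> together with
  \<open>c = v\<^sub>5(n)\<close>.

  The fourth child has \<open>t + 1\<close> and \<open>c + 1\<close> in place of \<open>t\<close> and \<open>c\<close>, which matches
  \<open>v\<^sub>5(5n) = v\<^sub>5(n) + 1\<close>. The other children have \<open>c = 0\<close>, their indices are prime to \<open>5\<close>, and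
  their value of \<open>t\<close> lies in the interval from \<open>0\<close> to \<open>1\<close>. The third child has the fraction
  \<open>2(c + 1) - t\<close>, which by the invariant has integral part \<open>c + 1 = v\<^sub>5(5n)\<close>; this is the required
  value, since the third child has index \<open>5n - 1\<close>. The fractions of the four other children are
  smaller than \<open>1\<close>, and the successors of their indices are prime to \<open>5\<close>.
\<close>

text \<open>The condition \<open>c < t \<le> c + 1\<close> on \<open>t = b / (3a)\<close> with denominators cleared. Since it is homogeneous in
  \<open>(a, b)\<close>, it does not depend on which branch produced a vertex.\<close>
definition reciprocal_bound :: "int \<times> int \<times> int \<Rightarrow> bool" where
  "reciprocal_bound = (\<lambda>(a, b, c). 0 < a \<and> 0 \<le> c \<and> 3 * a * c < b \<and> b \<le> 3 * a * (c + 1))"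

text \<open>One step down the tree. After clearing denominators every claim is linear in \<open>a\<close>, \<open>b\<close> and
  the product \<open>ac\<close>, and follows from \<open>3ac < b \<le> 3ac + 3a\<close> with \<open>ac \<ge> 0\<close>.\<close>
lemma reciprocal_bound_child:
  assumes inv: "reciprocal_bound (a, b, c)" and j: "j < 5"
    and child: "children (a, b, c) ! j = (a', b', c')"
  shows "reciprocal_bound (a', b', c')"
    and "c' = (if j = 3 then c + 1 else 0)"
    and "a' div b' = (if j = 2 then c + 1 else 0)"
proof -
  have a: "0 < a" and c: "0 \<le> c" and ac: "0 \<le> a * c"
    and lo: "3 * (a * c) < b" and hi: "b \<le> 3 * (a * c) + 3 * a"
    using inv by (auto simp: reciprocal_bound_def algebra_simps)
  have b: "0 < b"
    using ac lo by linarith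
  have j_cases: "j = 0 \<or> j = 1 \<or> j = 2 \<or> j = 3 \<or> j = 4"
    using j by auto
  have quotient: "x div y = q" if "q * y \<le> x" "x < q * y + y" for x y q :: int
    using that by (intro int_div_pos_eq[where r = "x - q * y"]) (auto simp: algebra_simps)
  have "case children (a, b, c) ! j of (a', b', c') \<Rightarrow>
    reciprocal_bound (a', b', c') \<and> c' = (if j = 3 then c + 1 else 0)
    \<and> a' div b' = (if j = 2 then c + 1 else 0)"
  proof (cases "3 dvd b")
    case False
    then show ?thesis
      using j_cases a c lo hi
      by (auto simp: children_def reciprocal_bound_def algebra_simps intro!: quotient;
        use a b ac in linarith)
  next
    case True
    then obtain k where k: "b = 3 * k" ..
    then show ?thesis
      using j_cases a c lo hi
      by (auto simp: k children_def reciprocal_bound_def algebra_simps intro!: quotient;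
        use a b ac k in linarith)
  qed
  then show "reciprocal_bound (a', b', c')" "c' = (if j = 3 then c + 1 else 0)"
    "a' div b' = (if j = 2 then c + 1 else 0)"
    by (auto simp: child)
qed

lemma multiplicity_5_mult:
  assumes "n \<ge> 1"
  shows "multiplicity 5 (5 * n) = Suc (multiplicity 5 (n :: nat))"
  using assms by (intro multiplicity_times_same) auto

text \<open>The invariant of the parent determines both the invariant and the integral part at a child,
  so one induction proves both.\<close>
lemma N_invariant:
  assumes "n \<ge> 1" "N n = (a, b, c)"
  shows "reciprocal_bound (a, b, c) \<and> c = int (multiplicity 5 n)
    \<and> a div b = int (multiplicity 5 (n + 1))"
  using assms
proof (induction n arbitrary: a b c rule: less_induct)
  case (less m)
  show ?case
  proof (cases "m = 1")
    case True
    have "multiplicity 5 (2 :: nat) = 0"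
      by (intro not_dvd_imp_multiplicity_0) simp
    then show ?thesis
      using True less.prems N_1 by (auto simp: reciprocal_bound_def numeral_2_eq_2)
  next
    case False
    define n j where "n = (m + 3) div 5" and "j = (m + 3) mod 5"
    have m: "m + 3 = 5 * n + j" and j: "j < 5"
      by (simp_all add: n_def j_def)
    have n: "n \<ge> 1" "n < m"
      using False less.prems(1) m j by linarith+
    obtain p q r where N_n: "N n = (p, q, r)"
      by (cases "N n")
    have child: "children (p, q, r) ! j = (a, b, c)"
      using less.prems(2) N_child[OF n(1) j] m N_n by (metis add_diff_cancel_right')
    have IH: "reciprocal_bound (p, q, r)" "r = int (multiplicity 5 n)"
      using less.IH[OF n(2,1) N_n] by auto
    \<comment> \<open>The multiples of 5 among the indices are those of fourth children, and the predecessors of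
      such multiples are those of third children.\<close>
    have "int (multiplicity 5 m) = (if j = 3 then r + 1 else 0)"
    proof (cases "j = 3")
      case True
      then have "m = 5 * n" using m by simp
      then show ?thesis using True IH(2) multiplicity_5_mult[OF n(1)] by simp
    next
      case False
      then have "\<not> 5 dvd m" using m j by presburger
      then show ?thesis using False by (simp add: not_dvd_imp_multiplicity_0)
    qed
    moreover have "int (multiplicity 5 (m + 1)) = (if j = 2 then r + 1 else 0)"
    proof (cases "j = 2")
      case True
      then have "m + 1 = 5 * n" using m by simp
      then show ?thesis using True IH(2) multiplicity_5_mult[OF n(1)] by simp
    next
      case False
      then have "\<not> 5 dvd m + 1" using m j by presburger
      then show ?thesis using False by (simp add: not_dvd_imp_multiplicity_0)
    qed
    ultimately show ?thesis
      using reciprocal_bound_child[OF IH(1) j child] by simp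
  qed
qed

theorem proposition4:
  fixes n :: nat
  assumes "n \<ge> 1"
  shows "\<lfloor>s (n - 1)\<rfloor> = int (multiplicity 5 n)"
proof (cases "n = 1")
  case True
  then show ?thesis
    by (simp add: s_def)
next
  case False
  obtain a b c where N: "N (n - 1) = (a, b, c)"
    by (cases "N (n - 1)")
  have "n - 1 \<ge> 1"
    using assms False by simp
  from N_invariant[OF this N] show ?thesis
    using assms \<open>n - 1 \<ge> 1\<close> N by (simp add: s_def floor_divide_of_int_eq)
qed

end
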